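(* Let $p$ be a prime number and let $\omega=e^{2\pi i/p}$. Let $f:\mathbb{Z}_p\longrightarrow \mathbb{Z}_p$ be a function. Suppose that the average \[ \mu_f^{1,b}=\frac{1}{p}\sum_{x=0}^{p-1}\omega^{f(x)+bx} \] is an algebraic integer for every $b\in\mathbb{Z}_p$. Then $f$ is a linear polynomial function.
   Context: $\mathbb{Z}_p=\{0,1,\ldots,p-1\}$ denotes the ring of integers modulo $p$. For $c\in\mathbb{Z}_p$, $\omega^c$ is well defined since $\omega^p=1$. A function $f:\mathbb{Z}_p\to\mathbb{Z}_p$ is a linear polynomial function if there exist $\alpha,\beta\in\mathbb{Z}_p$ such that $f(x)=\alpha x+\beta$ in $\mathbb{Z}_p$ for all $x\in\mathbb{Z}_p$ (the case $\alpha=0$ is allowed). *)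

theory Defs
  imports "HOL-Analysis.Analysis" "HOL-Number_Theory.Residues"
begin

text \<open>
  The ring of integers modulo \<open>p\<close> is \<^const>\<open>residue_ring\<close>, whose carrier is the set
  \<open>{0..p - 1}\<close> of integers. Since the exponents below are only relevant modulo \<open>p\<close>, they are
  computed with the integer representatives.
\<close>

definition omega :: "nat \<Rightarrow> complex"
  where "omega p = exp (2 * of_real pi * \<i> / of_nat p)"

definition mu :: "nat \<Rightarrow> (int \<Rightarrow> int) \<Rightarrow> int \<Rightarrow> int \<Rightarrow> complex"
  where "mu p f a b = (1 / of_nat p) * (\<Sum>x = 0..int p - 1. omega p powi (a * f x + b * x))"

definition linear_polynomial_function :: "nat \<Rightarrow> (int \<Rightarrow> int) \<Rightarrow> bool"
  where "linear_polynomial_function p f \<longleftrightarrow>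
    (\<exists>\<alpha> \<in> carrier (residue_ring (int p)). \<exists>\<beta> \<in> carrier (residue_ring (int p)).
      \<forall>x \<in> carrier (residue_ring (int p)).
        f x = \<alpha> \<otimes>\<^bsub>residue_ring (int p)\<^esub> x \<oplus>\<^bsub>residue_ring (int p)\<^esub> \<beta>)"

end

theory Submission
  imports Defs "Jordan_Normal_Form.Char_Poly"
begin

text \<open>
  The slope that matters is \<open>b = f 0 - f 1\<close>. For this \<open>b\<close> the map \<open>g x = f x + b x\<close> on the integers modulo
  \<open>p\<close> takes the same value at \<open>0\<close> and \<open>1\<close>. Let \<open>c k\<close> be the number of \<open>x\<close> with \<open>g x = k\<close>, so that
  the sum of the roots of unity is \<open>\<Sum>k<p. c k * \<omega> ^ k\<close>, where the \<open>c k\<close> are natural numbers with sum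
  \<open>p\<close>. If this sum divided by \<open>p\<close> is an algebraic integer, then all the \<open>c k\<close> are congruent modulo
  \<open>p\<close> (\<open>coeffs_cong_of_algebraic_int\<close>). Since \<open>c (g 0) \<ge> 2\<close>, either \<open>c (g 0) = p\<close>, or \<open>c (g 0)\<close> is
  the least nonnegative residue of every \<open>c k\<close>, and then all \<open>c k\<close> are at least \<open>2\<close> and their sum
  is too large. So \<open>c (g 0) = p\<close>: the map \<open>g\<close> is constant, and \<open>f x = f 0 - b x\<close>.

  The congruence of the coefficients rests on the total ramification of \<open>p\<close> in the cyclotomic field:
  \<open>p\<close> and \<open>(1 - \<omega>) ^ (p - 1)\<close> divide each other in the algebraic integers. Hence an integer divisible by
  \<open>1 - \<omega>\<close> is divisible by \<open>p\<close>. If \<open>C\<close> is an integer polynomial with \<open>p\<close> dividing \<open>C(\<omega>)\<close>,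
  this makes the first \<open>p - 1\<close> coefficients of the expansion of \<open>C\<close> in powers of \<open>1 - X\<close>
  divisible by \<open>p\<close>, one after the other (\<open>poly_factor_mod_prime\<close>). If \<open>C\<close> has degree below \<open>p\<close>, it is
  therefore a multiple of \<open>(1 - X) ^ (p - 1)\<close> modulo \<open>p\<close>, and the latter is congruent to
  \<open>1 + X + \<dots> + X ^ (p - 1)\<close>. Divisibility is taken in the ring of all
  algebraic integers; that they form a ring is proved with characteristic polynomials of integer
  matrices.
\<close>

hide_const (open) up_ring.coeff up_ring.monom Module.smult

section \<open>The ring of algebraic integers\<close>

interpretation int_span: Modules.module "\<lambda>(a::int) (x::complex). of_int a * x"
  by unfold_locales (auto simp: algebra_simps)

text \<open>The characteristic polynomial of the integer matrix is monic with integer coefficients.\<close>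

lemma int_matrix_eigenvalue_algebraic_int:
  fixes z :: complex and v :: "nat \<Rightarrow> complex" and a :: "nat \<Rightarrow> nat \<Rightarrow> int"
  assumes eq: "\<And>i. i < n \<Longrightarrow> z * v i = (\<Sum>j<n. of_int (a i j) * v j)"
    and nz: "k < n" "v k \<noteq> 0"
  shows "algebraic_int z"
proof -
  define A where "A = mat n n (\<lambda>(i, j). a i j)"
  define A' where "A' = map_mat (of_int :: int \<Rightarrow> complex) A"
  define w where "w = vec n v"
  have A: "A \<in> carrier_mat n n" and A': "A' \<in> carrier_mat n n"
    by (auto simp: A_def A'_def)
  have "vec_index w k \<noteq> 0"
    using nz by (simp add: w_def)
  hence "w \<noteq> 0\<^sub>v n"
    using nz by auto
  moreover have "A' *\<^sub>v w = z \<cdot>\<^sub>v w"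
    by (rule eq_vecI)
       (auto simp: A'_def A_def w_def eq scalar_prod_def atLeast0LessThan)
  ultimately have "eigenvector A' w z"
    using A' by (auto simp: eigenvector_def w_def)
  hence "eigenvalue A' z"
    unfolding eigenvalue_def by blast
  hence "poly (char_poly A') z = 0"
    using eigenvalue_root_char_poly[OF A'] by simp
  hence "poly (map_poly of_int (char_poly A)) z = 0"
    unfolding A'_def by (subst (asm) of_int_hom.char_poly_hom[OF A])
  moreover have "lead_coeff (char_poly A) = 1"
    using degree_monic_char_poly[OF A] by simp
  ultimately show ?thesis
    unfolding algebraic_int_altdef_ipoly by blast
qed

text \<open>
  The usual criterion of integrality: multiplication by \<open>z\<close> preserves a finitely generated group.
  Expanding \<open>z * b\<close> in the generators gives an integer matrix that has \<open>z\<close> as an eigenvalue, the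
  vector of all generators being an eigenvector.
\<close>

lemma finite_int_module_multiplier_algebraic_int:
  assumes fin: "finite B" and b0: "b0 \<in> B" "b0 \<noteq> 0"
    and stable: "\<And>b. b \<in> B \<Longrightarrow> z * b \<in> int_span.span B"
  shows "algebraic_int z"
proof -
  obtain v where v: "bij_betw v {..<card B} B"
    using ex_bij_betw_nat_finite[OF fin] by (auto simp: atLeast0LessThan)
  have "\<exists>u. z * b = (\<Sum>c\<in>B. of_int (u c) * c)" if "b \<in> B" for b
    using stable[OF that] unfolding int_span.span_finite[OF fin] by auto
  then obtain u where u: "\<And>b. b \<in> B \<Longrightarrow> z * b = (\<Sum>c\<in>B. of_int (u b c) * c)"
    by metis
  obtain k where k: "k < card B" "v k = b0"
    using v b0 by (auto simp: bij_betw_def image_iff) (metis imageE lessThan_iff)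
  show ?thesis
  proof (rule int_matrix_eigenvalue_algebraic_int)
    fix i assume "i < card B"
    hence "v i \<in> B"
      using v by (auto simp: bij_betw_def)
    thus "z * v i = (\<Sum>j<card B. of_int (u (v i) (v j)) * v j)"
      by (simp only: u sum.reindex_bij_betw[OF v, of "\<lambda>c. of_int (u (v i) c) * c"])
  qed (use k b0 in auto)
qed

lemma span_multiplier_span:
  assumes "\<And>b. b \<in> B \<Longrightarrow> z * b \<in> int_span.span B" and "s \<in> int_span.span B"
  shows "z * s \<in> int_span.span B"
  using assms(2)
proof (induction rule: int_span.span_induct_alt)
  case base
  show ?case by (simp add: int_span.span_zero)
next
  case (step c b s)
  have "of_int c * (z * b) + z * s \<in> int_span.span B"
    by (intro int_span.span_add int_span.span_scale assms step)
  thus ?case by (simp add: algebra_simps)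
qed

lemma algebraic_int_power_relation:
  assumes "algebraic_int (x :: complex)"
  obtains n a where "n > 0" "x ^ n = (\<Sum>i<n. of_int (a i) * x ^ i)"
proof -
  obtain P where P: "poly (map_poly of_int P) x = 0" "lead_coeff P = 1"
    using assms unfolding algebraic_int_altdef_ipoly by blast
  define n where "n = degree P"
  have "0 = (\<Sum>i\<le>n. of_int (coeff P i) * x ^ i)"
    using P(1) by (simp add: poly_altdef n_def)
  also have "\<dots> = x ^ n + (\<Sum>i<n. of_int (coeff P i) * x ^ i)"
    using P(2) by (simp add: n_def lessThan_Suc_atMost[symmetric])
  finally have "x ^ n = (\<Sum>i<n. of_int (- coeff P i) * x ^ i)"
    by (simp add: sum_negf eq_neg_iff_add_eq_0)
  moreover have "n > 0"
    using calculation by (intro Nat.gr0I) auto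
  ultimately show ?thesis
    using that[of n "\<lambda>i. - coeff P i"] by blast
qed

text \<open>
  The products \<open>x ^ i * y ^ j\<close> with exponents below the degrees of the two monic equations generate a
  group that both \<open>x\<close> and \<open>y\<close> preserve. Hence \<open>x + y\<close> and \<open>x * y\<close> preserve it too, which makes them
  integral.
\<close>

lemma algebraic_int_common_module:
  assumes "algebraic_int (x :: complex)" "algebraic_int y"
  obtains B where "finite B" "1 \<in> B"
    "\<And>b. b \<in> B \<Longrightarrow> x * b \<in> int_span.span B"
    "\<And>b. b \<in> B \<Longrightarrow> y * b \<in> int_span.span B"
proof -
  obtain n a where n: "n > 0" "x ^ n = (\<Sum>i<n. of_int (a i) * x ^ i)"
    using algebraic_int_power_relation[OF assms(1)] by blast
  obtain m c where m: "m > 0" "y ^ m = (\<Sum>i<m. of_int (c i) * y ^ i)"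
    using algebraic_int_power_relation[OF assms(2)] by blast
  define B where "B = (\<lambda>(i, j). x ^ i * y ^ j) ` ({..<n} \<times> {..<m})"
  have B: "x ^ i * y ^ j \<in> int_span.span B" if "i < n" "j < m" for i j
    by (rule int_span.span_base) (use that in \<open>auto simp: B_def\<close>)
  show ?thesis
  proof (rule that)
    show "finite B" by (simp add: B_def)
    show "1 \<in> B"
      unfolding B_def by (rule image_eqI[of _ _ "(0, 0)"]) (use n m in auto)
  next
    fix b assume "b \<in> B"
    then obtain i j where ij: "i < n" "j < m" "b = x ^ i * y ^ j"
      by (auto simp: B_def)
    show "x * b \<in> int_span.span B"
    proof (cases "Suc i < n")
      case True
      thus ?thesis using B[of "Suc i" j] ij by (simp add: mult_ac)
    next
      case False
      hence "Suc i = n" using ij by simp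
      hence "x * b = x ^ n * y ^ j"
        using ij by (auto simp: mult_ac)
      also have "\<dots> = (\<Sum>i<n. of_int (a i) * (x ^ i * y ^ j))"
        unfolding n(2) sum_distrib_right by (simp only: mult_ac)
      also have "\<dots> \<in> int_span.span B"
        by (intro int_span.span_sum int_span.span_scale B) (use ij in auto)
      finally show ?thesis .
    qed
    show "y * b \<in> int_span.span B"
    proof (cases "Suc j < m")
      case True
      thus ?thesis using B[of i "Suc j"] ij by (simp add: mult_ac)
    next
      case False
      hence "Suc j = m" using ij by simp
      hence "y * b = x ^ i * y ^ m"
        using ij by (auto simp: mult_ac)
      also have "\<dots> = (\<Sum>j<m. of_int (c j) * (x ^ i * y ^ j))"
        unfolding m(2) sum_distrib_left by (simp only: mult_ac)
      also have "\<dots> \<in> int_span.span B"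
        by (intro int_span.span_sum int_span.span_scale B) (use ij in auto)
      finally show ?thesis .
    qed
  qed
qed

lemma
  assumes "algebraic_int (x :: complex)" "algebraic_int y"
  shows algebraic_int_add: "algebraic_int (x + y)"
    and algebraic_int_mult: "algebraic_int (x * y)"
proof -
  obtain B where B: "finite B" "1 \<in> B"
    and x: "\<And>b. b \<in> B \<Longrightarrow> x * b \<in> int_span.span B"
    and y: "\<And>b. b \<in> B \<Longrightarrow> y * b \<in> int_span.span B"
    using algebraic_int_common_module[OF assms] by blast
  show "algebraic_int (x + y)"
    by (rule finite_int_module_multiplier_algebraic_int[OF B])
       (simp_all add: distrib_right int_span.span_add x y)
  show "algebraic_int (x * y)"
    by (rule finite_int_module_multiplier_algebraic_int[OF B])
       (simp_all add: mult.assoc span_multiplier_span[OF x] y)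
qed

lemma algebraic_int_diff:
  "algebraic_int (x :: complex) \<Longrightarrow> algebraic_int y \<Longrightarrow> algebraic_int (x - y)"
  using algebraic_int_add[of x "-y"] by simp

lemma algebraic_int_sum:
  "(\<And>i. i \<in> I \<Longrightarrow> algebraic_int (g i :: complex)) \<Longrightarrow> algebraic_int (sum g I)"
  by (induction I rule: infinite_finite_induct) (auto intro: algebraic_int_add)

lemma algebraic_int_prod:
  "(\<And>i. i \<in> I \<Longrightarrow> algebraic_int (g i :: complex)) \<Longrightarrow> algebraic_int (prod g I)"
  by (induction I rule: infinite_finite_induct) (auto intro: algebraic_int_mult)

lemma algebraic_int_power:
  "algebraic_int (x :: complex) \<Longrightarrow> algebraic_int (x ^ n)"
  by (induction n) (auto intro: algebraic_int_mult)

lemma algebraic_int_poly_of_int: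
  "algebraic_int (x :: complex) \<Longrightarrow> algebraic_int (poly (of_int_poly P) x)"
  unfolding poly_altdef
  by (intro algebraic_int_sum algebraic_int_mult algebraic_int_power) auto

section \<open>Ramification of a prime in the field of its roots of unity\<close>

text \<open>
  The assumptions make \<open>\<zeta>\<close> a primitive \<open>p\<close>-th root of unity, because \<open>p\<close> is prime.
\<close>

locale prime_root_of_unity =
  fixes p :: nat and \<zeta> :: complex
  assumes prime: "prime p" and root: "\<zeta> ^ p = 1" and neq_1: "\<zeta> \<noteq> 1"
begin

lemma p_gt_1: "p > 1"
  using prime by (rule prime_gt_1_nat)

lemma power_mod: "\<zeta> ^ n = \<zeta> ^ (n mod p)"
proof -
  have "\<zeta> ^ n = \<zeta> ^ (p * (n div p) + n mod p)" by simp
  also have "\<dots> = \<zeta> ^ (n mod p)"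
    unfolding power_add power_mult by (simp add: root)
  finally show ?thesis .
qed

lemma power_inverse_exponent:
  assumes "0 < a" "a < p"
  obtains b where "(\<zeta> ^ a) ^ b = \<zeta>"
proof -
  have "coprime a p"
    using assms prime by (metis coprime_commute nat_dvd_not_less prime_imp_coprime)
  then obtain b where "[a * b = 1] (mod p)"
    using cong_solve_coprime_nat by auto
  hence "(\<zeta> ^ a) ^ b = \<zeta>"
    using p_gt_1 power_mod[of "a * b"] by (simp add: cong_def power_mult)
  thus ?thesis by (rule that)
qed

lemma power_eq_1_iff:
  assumes "a < p"
  shows "\<zeta> ^ a = 1 \<longleftrightarrow> a = 0"
  using power_inverse_exponent[of a] assms neq_1 by fastforce

lemma nonzero: "\<zeta> \<noteq> 0"
  using root p_gt_1 by (auto simp: power_0_left)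

lemma inj_on_power: "inj_on (\<lambda>a. \<zeta> ^ a) {..<p}"
proof (rule linorder_inj_onI)
  fix a b assume "a < b" "a \<in> {..<p}" "b \<in> {..<p}"
  hence "\<zeta> ^ (b - a) \<noteq> 1"
    by (subst power_eq_1_iff) auto
  thus "\<zeta> ^ a \<noteq> \<zeta> ^ b"
    using nonzero \<open>a < b\<close> by (simp add: power_diff)
qed auto

lemma algebraic_int_root_of_unity: "algebraic_int \<zeta>"
  by (rule algebraic_int_root[of 1 "monom 1 p"])
     (use root p_gt_1 in \<open>auto simp: poly_monom degree_monom_eq coeff_monom\<close>)

text \<open>
  This is the factorization of \<open>1 + X + \<dots> + X ^ (p - 1)\<close> into the factors \<open>X - \<zeta> ^ a\<close>, evaluated
  at \<open>X = 1\<close>.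
\<close>

lemma prod_1_minus_powers: "(\<Prod>a = 1..<p. 1 - \<zeta> ^ a) = of_nat p"
proof -
  have "(\<Prod>a = 1..<p. [:- (\<zeta> ^ a), 1:]) = (\<Sum>i<p. monom 1 i)"
  proof (rule poly_eqI_degree_lead_coeff[where n = "p - 1" and A = "(\<lambda>a. \<zeta> ^ a) ` {1..<p}"])
    have deg: "degree (\<Prod>a = 1..<p. [:- (\<zeta> ^ a), 1:]) = p - 1"
      by (subst degree_prod_eq_sum_degree) auto
    have "lead_coeff (\<Prod>a = 1..<p. [:- (\<zeta> ^ a), 1:]) = 1"
      by (simp add: lead_coeff_prod)
    hence "coeff (\<Prod>a = 1..<p. [:- (\<zeta> ^ a), 1:]) (p - 1) = 1"
      by (simp only: deg)
    also have "1 = coeff (\<Sum>i<p. monom (1 :: complex) i) (p - 1)"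
      using p_gt_1 by (simp add: coeff_sum)
    finally show "coeff (\<Prod>a = 1..<p. [:- (\<zeta> ^ a), 1:]) (p - 1) = coeff (\<Sum>i<p. monom 1 i) (p - 1)" .
    show "degree (\<Prod>a = 1..<p. [:- (\<zeta> ^ a), 1:]) \<le> p - 1"
      by (simp only: deg order.refl)
    show "degree (\<Sum>i<p. monom (1 :: complex) i) \<le> p - 1"
      by (intro degree_sum_le) (auto simp: degree_monom_eq)
    show "card ((\<lambda>a. \<zeta> ^ a) ` {1..<p}) \<ge> p - 1"
      by (subst card_image) (auto intro: inj_on_subset[OF inj_on_power])
    fix z assume "z \<in> (\<lambda>a. \<zeta> ^ a) ` {1..<p}"
    then obtain a where a: "1 \<le> a" "a < p" "z = \<zeta> ^ a" by auto
    have "z \<noteq> 1" using a power_eq_1_iff by auto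
    moreover have "z ^ p = 1"
      using a by (metis mult.commute power_mult power_one root)
    ultimately have "(\<Sum>i<p. z ^ i) = 0"
      by (simp add: geometric_sum)
    moreover have "(\<Prod>a = 1..<p. z - \<zeta> ^ a) = 0"
      using a by (intro prod_zero) auto
    ultimately show "poly (\<Prod>a = 1..<p. [:- (\<zeta> ^ a), 1:]) z = poly (\<Sum>i<p. monom 1 i) z"
      by (simp add: poly_prod poly_sum poly_monom)
  qed
  hence "poly (\<Prod>a = 1..<p. [:- (\<zeta> ^ a), 1:]) 1 = poly (\<Sum>i<p. monom 1 i) 1"
    by (rule arg_cong)
  thus ?thesis by (simp add: poly_prod poly_sum poly_monom)
qed

text \<open>
  All factors \<open>1 - \<zeta> ^ a\<close> of \<open>p\<close> are associated to \<open>1 - \<zeta>\<close>: each of \<open>\<zeta>\<close> and \<open>\<zeta> ^ a\<close> is a power of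
  the other, and \<open>1 - z\<close> divides \<open>1 - z ^ b\<close>. So \<open>p\<close> is a unit times \<open>(1 - \<zeta>) ^ (p - 1)\<close>; the next two
  lemmas are the two divisibilities.
\<close>

lemma algebraic_int_prime_over_power: "algebraic_int (of_nat p / (1 - \<zeta>) ^ (p - 1))"
proof -
  have "of_nat p / (1 - \<zeta>) ^ (p - 1) = (\<Prod>a = 1..<p. (1 - \<zeta> ^ a) / (1 - \<zeta>))"
    unfolding prod_dividef prod_1_minus_powers by simp
  also have "\<dots> = (\<Prod>a = 1..<p. \<Sum>i<a. \<zeta> ^ i)"
    using neq_1 by (intro prod.cong) (auto simp: one_diff_power_eq)
  also have "algebraic_int \<dots>"
    by (intro algebraic_int_prod algebraic_int_sum algebraic_int_power algebraic_int_root_of_unity)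
  finally show ?thesis .
qed

lemma algebraic_int_power_over_prime: "algebraic_int ((1 - \<zeta>) ^ (p - 1) / of_nat p)"
proof -
  have "(1 - \<zeta>) ^ (p - 1) / of_nat p = (\<Prod>a = 1..<p. (1 - \<zeta>) / (1 - \<zeta> ^ a))"
    unfolding prod_dividef prod_1_minus_powers by simp
  also have "algebraic_int \<dots>"
  proof (rule algebraic_int_prod)
    fix a assume a: "a \<in> {1..<p}"
    obtain b where b: "(\<zeta> ^ a) ^ b = \<zeta>"
      using power_inverse_exponent[of a] a by auto
    have "1 - \<zeta> ^ a \<noteq> 0"
      using power_eq_1_iff[of a] a by auto
    moreover have "1 - \<zeta> = (1 - \<zeta> ^ a) * (\<Sum>i<b. (\<zeta> ^ a) ^ i)"
      using one_diff_power_eq[of "\<zeta> ^ a" b] b by simp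
    ultimately have "(1 - \<zeta>) / (1 - \<zeta> ^ a) = (\<Sum>i<b. (\<zeta> ^ a) ^ i)"
      by (simp add: field_simps)
    thus "algebraic_int ((1 - \<zeta>) / (1 - \<zeta> ^ a))"
      by (simp add: algebraic_int_sum algebraic_int_power algebraic_int_root_of_unity)
  qed
  finally show ?thesis .
qed

text \<open>
  The power \<open>(d / (1 - \<zeta>)) ^ (p - 1)\<close> is \<open>d ^ (p - 1) / p\<close> up to a unit, and a rational algebraic
  integer is an integer.
\<close>

lemma prime_dvd_of_algebraic_int_quotient:
  assumes "algebraic_int (of_int d / (1 - \<zeta>))"
  shows "int p dvd d"
proof -
  let ?q = "of_int (d ^ (p - 1)) / of_int (int p) :: complex"
  have "?q = (of_int d / (1 - \<zeta>)) ^ (p - 1) * ((1 - \<zeta>) ^ (p - 1) / of_nat p)"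
    using neq_1 by (simp add: power_divide)
  hence "algebraic_int ?q"
    by (simp only: algebraic_int_mult algebraic_int_power assms algebraic_int_power_over_prime)
  moreover have "?q \<in> \<rat>" by auto
  ultimately have "?q \<in> \<int>"
    by (rule rational_algebraic_int_is_int)
  then obtain k where "?q = of_int k"
    by (auto elim: Ints_cases)
  hence "(of_int (d ^ (p - 1)) :: complex) = of_int (int p * k)"
    using p_gt_1 by (simp add: field_simps)
  hence "int p dvd d ^ (p - 1)"
    unfolding of_int_eq_iff by simp
  thus ?thesis
    using prime by (metis prime_dvd_power prime_int_nat_transfer prime_nat_int_transfer)
qed

section \<open>Integer polynomials whose value is divisible by the prime\<close>

text \<open>
  In the step, write \<open>D = (1 - X) Q + d\<close> with \<open>d = D(1)\<close>. As \<open>m + 1 \<le> p - 1\<close>, both \<open>C(\<zeta>)\<close> and \<open>p\<close> are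
  divisible by \<open>(1 - \<zeta>) ^ (m + 1)\<close>, hence \<open>1 - \<zeta>\<close> divides \<open>D(\<zeta>)\<close> and so also \<open>d\<close>. Then \<open>p\<close> divides
  \<open>d\<close>, and the remainder moves into the term with factor \<open>p\<close>.
\<close>

lemma poly_factor_mod_prime:
  assumes C: "algebraic_int (poly (of_int_poly C) \<zeta> / of_nat p)" and m: "m \<le> p - 1"
  shows "\<exists>D E. C = [:1, -1:] ^ m * D + smult (int p) E \<and> degree D \<le> degree C - m"
  using m
proof (induction m)
  case 0
  show ?case by (rule exI[of _ C], rule exI[of _ 0]) simp
next
  case (Suc m)
  let ?ev = "\<lambda>P. poly (of_int_poly P) \<zeta>"
  define l where "l = 1 - \<zeta>"
  obtain D E where D: "C = [:1, -1:] ^ m * D + smult (int p) E" "degree D \<le> degree C - m"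
    using Suc by auto
  (* The sign turns division by X - 1 into division by 1 - X. *)
  define Q where "Q = - synthetic_div D 1"
  define d where "d = poly D 1"
  have DQ: "D = [:1, -1:] * Q + [:d:]"
    using synthetic_div_correct'[of 1 D] by (simp add: Q_def d_def)
  have l: "l \<noteq> 0" using neq_1 by (simp add: l_def)
  have "?ev C = l ^ m * ?ev D + of_nat p * ?ev E"
    by (simp add: D(1) hom_distribs l_def)
  hence "?ev C / l ^ Suc m = l ^ m * ?ev D / l ^ Suc m + of_nat p / l ^ Suc m * ?ev E"
    by (simp only: add_divide_distrib times_divide_eq_left)
  also have "l ^ m * ?ev D / l ^ Suc m = ?ev D / l"
    using l by simp
  finally have evD: "?ev D / l = ?ev C / l ^ Suc m - of_nat p / l ^ Suc m * ?ev E"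
    by simp
  have "?ev D = l * ?ev Q + of_int d"
    using arg_cong[OF DQ, of ?ev]
    unfolding of_int_poly_hom.hom_add of_int_poly_hom.hom_mult poly_add poly_mult
    by (simp add: l_def of_int_hom.map_poly_pCons_hom)
  hence "of_int d / l = ?ev D / l - ?ev Q"
    using l by (simp add: field_simps)
  hence quot: "of_int d / l = ?ev C / l ^ Suc m - of_nat p / l ^ Suc m * ?ev E - ?ev Q"
    by (simp only: evD)
  have "l ^ (p - 1) = l ^ (p - 1 - Suc m) * l ^ Suc m"
    using Suc.prems unfolding power_add[symmetric] by (intro arg_cong[of _ _ "power l"]) linarith
  hence "of_nat p / l ^ Suc m = of_nat p / l ^ (p - 1) * l ^ (p - 1 - Suc m)"
    using l by simp
  moreover have "algebraic_int l"
    unfolding l_def by (intro algebraic_int_diff algebraic_int_1 algebraic_int_root_of_unity)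
  ultimately have pl: "algebraic_int (of_nat p / l ^ Suc m)"
    using algebraic_int_prime_over_power
    by (simp only: algebraic_int_mult algebraic_int_power l_def)
  have "?ev C / l ^ Suc m = ?ev C / of_nat p * (of_nat p / l ^ Suc m)"
    using p_gt_1 by simp
  hence "algebraic_int (?ev C / l ^ Suc m)"
    by (simp only: algebraic_int_mult C pl)
  hence "algebraic_int (of_int d / l)"
    unfolding quot
    by (intro algebraic_int_diff algebraic_int_mult pl algebraic_int_poly_of_int
          algebraic_int_root_of_unity)
  hence "int p dvd d"
    unfolding l_def by (rule prime_dvd_of_algebraic_int_quotient)
  then obtain e where e: "d = int p * e" by blast
  have "C = [:1, -1:] ^ Suc m * Q + smult (int p) (E + smult e ([:1, -1:] ^ m))"
    unfolding D(1) by (subst DQ) (simp add: e algebra_simps smult_add_right)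
  moreover have "degree Q \<le> degree C - Suc m"
    using D(2) by (simp add: Q_def degree_synthetic_div)
  ultimately show ?case by blast
qed

text \<open>
  Modulo \<open>p\<close> the polynomial \<open>C\<close> is \<open>d * (1 - X) ^ (p - 1)\<close>. One further factor \<open>1 - X\<close> turns the
  coefficients of \<open>C\<close> into the differences of neighbours, and the power into \<open>(1 - X) ^ p\<close>, whose
  inner coefficients are divisible by \<open>p\<close>.
\<close>

lemma coeffs_cong_of_algebraic_int:
  assumes "algebraic_int (poly (of_int_poly C) \<zeta> / of_nat p)"
    and deg: "degree C < p" and "i < p" "j < p"
  shows "[coeff C i = coeff C j] (mod int p)"
proof -
  obtain D E where D: "C = [:1, -1:] ^ (p - 1) * D + smult (int p) E"
    and "degree D \<le> degree C - (p - 1)"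
    using poly_factor_mod_prime[OF assms(1) order.refl] by blast
  hence "degree D = 0" using deg by simp
  then obtain d where d: "D = [:d:]" by (rule degree_eq_zeroE)
  have eq: "[:1, -1:] * C = smult d ([:1, -1:] ^ p) + smult (int p) ([:1, -1:] * E)"
    using p_gt_1 unfolding D d by (cases p) (simp_all add: algebra_simps smult_add_right)
  have step: "[coeff C (Suc k) = coeff C k] (mod int p)" if k: "Suc k < p" for k
  proof -
    have "coeff C (Suc k) - coeff C k = coeff ([:1, -1:] * C) (Suc k)"
      by simp
    also have "\<dots> = d * coeff ([:1, -1:] ^ p) (Suc k) + int p * coeff ([:1, -1:] * E) (Suc k)"
      by (simp only: eq coeff_add coeff_smult)
    also have "coeff ([:1, -1 :: int:] ^ p) (Suc k) = int (p choose Suc k) * (-1) ^ Suc k"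
      using k by (subst coeff_linear_poly_power) auto
    finally have "coeff C (Suc k) - coeff C k =
      d * (int (p choose Suc k) * (-1) ^ Suc k) + int p * coeff ([:1, -1:] * E) (Suc k)" .
    moreover have "int p dvd int (p choose Suc k)"
      using prime k by (auto intro: dvd_choose_prime)
    ultimately show ?thesis
      by (simp add: cong_iff_dvd_diff)
  qed
  have "[coeff C k = coeff C 0] (mod int p)" if "k < p" for k
    using that
  proof (induction k)
    case (Suc k)
    thus ?case using step[of k] cong_trans by auto
  qed auto
  thus ?thesis using assms(3,4) cong_sym cong_trans by blast
qed

section \<open>Averages of roots of unity\<close>

text \<open>
  The fibre sizes \<open>c k\<close> are congruent modulo \<open>p\<close>. If \<open>g\<close> is not constant, the fibre over \<open>g x\<close> has
  fewer than \<open>p\<close> elements, so its size is the smallest member of the common residue class. But it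
  contains \<open>x\<close> and \<open>y\<close>, so all \<open>p\<close> fibres have at least two elements, which is too many for \<open>X\<close>.
\<close>

lemma constant_of_algebraic_int_average:
  fixes g :: "'a \<Rightarrow> nat"
  assumes card: "card X = p" and g: "\<And>x. x \<in> X \<Longrightarrow> g x < p"
    and alg: "algebraic_int ((\<Sum>x\<in>X. \<zeta> ^ g x) / of_nat p)"
    and xy: "x \<in> X" "y \<in> X" "x \<noteq> y" "g x = g y"
    and z: "z \<in> X"
  shows "g z = g x"
proof (rule ccontr)
  assume neq: "g z \<noteq> g x"
  have fin: "finite X" using card p_gt_1 by (intro card_ge_0_finite) simp
  define c where "c k = card {u \<in> X. g u = k}" for k
  define C :: "int poly" where "C = (\<Sum>u\<in>X. monom 1 (g u))"
  have coeff: "coeff C k = int (c k)" for k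
    using fin by (simp add: C_def c_def coeff_sum coeff_monom sum.If_cases Int_def)
  have "poly (of_int_poly C) \<zeta> = (\<Sum>u\<in>X. \<zeta> ^ g u)"
    by (simp add: C_def hom_distribs poly_sum poly_monom)
  moreover have "degree C \<le> p - 1"
    unfolding C_def
  proof (rule degree_sum_le[OF fin])
    fix u assume "u \<in> X"
    show "degree (monom (1 :: int) (g u)) \<le> p - 1"
      using g[OF \<open>u \<in> X\<close>] by (simp add: degree_monom_eq)
  qed
  hence "degree C < p"
    using p_gt_1 by linarith
  ultimately have cong: "[c i = c j] (mod p)" if "i < p" "j < p" for i j
    using coeffs_cong_of_algebraic_int[of C i j] alg that by (simp add: coeff cong_int_iff)
  have sum: "(\<Sum>k<p. c k) = p"
    using card sum.group[of X "{..<p}" g "\<lambda>_. 1 :: nat"] fin g by (auto simp: c_def)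
  have "{x, y} \<subseteq> {u \<in> X. g u = g x}" using xy by auto
  hence two: "2 \<le> c (g x)"
    using card_mono[of "{u \<in> X. g u = g x}" "{x, y}"] fin xy by (simp add: c_def)
  have "{u \<in> X. g u = g x} \<subset> X"
    using neq z by auto
  hence lt: "c (g x) < p"
    unfolding c_def card[symmetric] using fin by (rule psubset_card_mono[rotated])
  have "c (g x) \<le> c k" if "k < p" for k
  proof -
    have "c (g x) = c k mod p"
      using cong[of "g x" k] that g[OF xy(1)] lt by (simp add: cong_def)
    thus ?thesis by simp
  qed
  hence "(\<Sum>k<p. 2) \<le> (\<Sum>k<p. c k)"
    using two by (intro sum_mono) fastforce
  thus False using sum p_gt_1 by simp
qed

end

lemma prime_root_of_unity_omega:
  assumes "prime p"
  shows "prime_root_of_unity p (omega p)"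
proof
  have p: "p > 1" using assms by (rule prime_gt_1_nat)
  show "omega p ^ p = 1"
    using p complex_root_unity[of p 1] by (simp add: omega_def)
  show "omega p \<noteq> 1"
    using p complex_root_unity_eq_1[of p 1] by (simp add: omega_def)
qed fact

theorem theorem9:
  fixes p :: nat and f :: "int \<Rightarrow> int"
  assumes "prime p"
    and "f \<in> carrier (residue_ring (int p)) \<rightarrow> carrier (residue_ring (int p))"
    and "\<And>b. b \<in> carrier (residue_ring (int p)) \<Longrightarrow> algebraic_int (mu p f 1 b)"
  shows "linear_polynomial_function p f"
proof -
  interpret prime_root_of_unity p "omega p"
    using assms(1) by (rule prime_root_of_unity_omega)
  have carrier: "carrier (residue_ring (int p)) = {0..int p - 1}"
    by (simp add: residue_ring_def)
  have f: "f x \<in> {0..int p - 1}" if "x \<in> {0..int p - 1}" for x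
    using assms(2) that unfolding carrier by auto
  (* The slope that makes f x + b x agree at 0 and 1. *)
  define b where "b = (f 0 - f 1) mod int p"
  define g where "g x = nat ((f x + b * x) mod int p)" for x
  have g_cong: "[int (g x) = f x + b * x] (mod int p)" for x
    using p_gt_1 by (simp add: g_def cong_def)
  have b: "b \<in> {0..int p - 1}"
    using p_gt_1 by (simp add: b_def)
  have "omega p powi (f x + b * x) = omega p ^ g x" for x
  proof -
    obtain k where k: "f x + b * x = int (g x) + int p * k"
      using g_cong[of x] by (metis cong_iff_lin)
    show ?thesis
      using nonzero root by (simp add: k power_int_add power_int_mult)
  qed
  hence "mu p f 1 b = (\<Sum>x = 0..int p - 1. omega p ^ g x) / of_nat p"
    by (simp add: mu_def)
  hence alg: "algebraic_int ((\<Sum>x = 0..int p - 1. omega p ^ g x) / of_nat p)"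
    using assms(3)[of b] b carrier by simp
  have "g 1 = g 0"
    by (simp add: g_def b_def mod_simps)
  hence const: "g x = g 0" if "x \<in> {0..int p - 1}" for x
    using constant_of_algebraic_int_average[OF _ _ alg, of 0 1 x] that p_gt_1
    by (auto simp: g_def nat_less_iff)
  have "f x = ((- b) mod int p * x mod int p + f 0) mod int p" if x: "x \<in> {0..int p - 1}" for x
  proof -
    have "[f x + b * x = f 0] (mod int p)"
      using g_cong[of x] g_cong[of 0] const[OF x] by (simp add: cong_def)
    hence "[f x = - b * x + f 0] (mod int p)"
      by (simp add: cong_iff_dvd_diff algebra_simps)
    moreover have "f x mod int p = f x"
      using f[OF x] by simp
    ultimately show ?thesis
      by (simp add: cong_def mod_simps)
  qed
  moreover have "(- b) mod int p \<in> {0..int p - 1}" "f 0 \<in> {0..int p - 1}"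
    using f[of 0] p_gt_1 by auto
  moreover have "\<alpha> \<otimes>\<^bsub>residue_ring (int p)\<^esub> x \<oplus>\<^bsub>residue_ring (int p)\<^esub> \<beta> =
      (\<alpha> * x mod int p + \<beta>) mod int p" for \<alpha> \<beta> x
    by (simp add: residue_ring_def)
  ultimately show ?thesis
    unfolding linear_polynomial_function_def carrier by metis
qed

end
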